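(* Let $\mathcal{I}=\{\mathbf{u}\in\mathbb{R}^{n_u} : \mathbf{u}^L\preceq\mathbf{u}\preceq\mathbf{u}^U\}$, let $g_{p,1},\dots,g_{p,n_g}:\mathbb{R}^{n_u}\to\mathbb{R}$ be twice continuously differentiable over $\mathcal{I}$, and let $\kappa_{ji}$ be constants with $$-\kappa_{ji} < \frac{\partial g_{p,j}}{\partial u_i}\Big|_{\mathbf{u}} < \kappa_{ji},\qquad \forall\,\mathbf{u}\in\mathcal{I},\ i=1,\dots,n_u,\ j=1,\dots,n_g .$$ Let $\mathbf{u}_k\in\mathcal{I}$ satisfy $g_{p,j}(\mathbf{u}_k)<0$ for all $j=1,\dots,n_g$, let $\mathbf{u}^*_{k+1}\in\mathcal{I}$ with $\mathbf{u}^*_{k+1}\neq\mathbf{u}_k$ (the target provided by the RTO algorithm), and let $$\mathbf{u}_{k+1}=\mathbf{u}_k+K_k(\mathbf{u}^*_{k+1}-\mathbf{u}_k),\qquad K_k\in[0,1].$$ If $$K_k\le \min_{j=1,\dots,n_g}\left[\frac{-g_{p,j}(\mathbf{u}_k)}{\sum_{i=1}^{n_u}\kappa_{ji}\,|u^*_{k+1,i}-u_{k,i}|}\right],$$ then $g_{p,j}(\mathbf{u}_{k+1})<0$ for all $j=1,\dots,n_g$.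
   Context: $\prec,\preceq$ between vectors denote componentwise (strict, nonstrict) inequality; $u_{k,i}$ is the $i$-th component of $\mathbf{u}_k$. The vectors $\mathbf{u}^L,\mathbf{u}^U\in\mathbb{R}^{n_u}$ are given lower and upper input limits. An "RTO algorithm" is any rule producing at iteration $k$ a target $\mathbf{u}^*_{k+1}$, which is then filtered with gain $K_k\in[0,1]$. *)

theory Defs
  imports "HOL-Analysis.Analysis"
begin

(* Twice continuous differentiability over a set that need not be open is
   understood, as usual, as holding on some open set containing it: f' and f''
   below are the first and second Frechet derivatives of f there. *)
definition C2_over :: "('a::euclidean_space \<Rightarrow> real) \<Rightarrow> 'a set \<Rightarrow> bool" where
  "C2_over f S \<longleftrightarrow>
     (\<exists>U (f' :: 'a \<Rightarrow> 'a \<Rightarrow>\<^sub>L real) (f'' :: 'a \<Rightarrow> 'a \<Rightarrow>\<^sub>L 'a \<Rightarrow>\<^sub>L real).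
        open U \<and> S \<subseteq> U \<and>
        (\<forall>x\<in>U. (f has_derivative blinfun_apply (f' x)) (at x)) \<and>
        (\<forall>x\<in>U. (f' has_derivative blinfun_apply (f'' x)) (at x)) \<and>
        continuous_on U f'')"

(* As with deriv, the value is meaningful only where the partial derivative
   exists; for f satisfying C2_over f S this is the case at every point of S. *)
definition partial_deriv :: "'n::finite \<Rightarrow> (real ^ 'n \<Rightarrow> real) \<Rightarrow> real ^ 'n \<Rightarrow> real" where
  "partial_deriv i f u = deriv (\<lambda>t. f (u + t *\<^sub>R axis i 1)) 0"

(* The order on vectors is the componentwise one. *)
definition input_box :: "real ^ 'n \<Rightarrow> real ^ 'n \<Rightarrow> (real ^ 'n) set" where
  "input_box uL uU = {u. uL \<le> u \<and> u \<le> uU}"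

end

theory Submission
  imports Defs
begin

text \<open>
  By the mean value theorem along the segment from \<open>u_k\<close> to \<open>u_next\<close>, the increment of \<open>g j\<close>
  is \<open>K\<close> times a directional derivative at a point of the (convex) box. That derivative is strictly
  below \<open>\<Sum>i. \<kappa> j i * \<bar>u_star $ i - u_k $ i\<bar>\<close>, and the bound on \<open>K\<close> says exactly that \<open>K\<close> times
  this sum does not exceed the slack \<open>- g j u_k\<close>.
\<close>

lemma C2_over_imp_has_derivative:
  assumes "C2_over f S"
  obtains f' where "\<And>x. x \<in> S \<Longrightarrow> (f has_derivative f' x) (at x)"
proof -
  obtain U and F :: "'a \<Rightarrow> 'a \<Rightarrow>\<^sub>L real" where "S \<subseteq> U"
    and "\<forall>x\<in>U. (f has_derivative blinfun_apply (F x)) (at x)"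
    using assms unfolding C2_over_def by blast
  then show thesis
    by (intro that[of "\<lambda>x. blinfun_apply (F x)"]) auto
qed

text \<open>Chain rule along the line through \<open>u\<close> in direction
  \<open>axis i 1\<close>.\<close>

lemma has_derivative_imp_partial_deriv:
  assumes "(f has_derivative f') (at u)"
  shows "partial_deriv i f u = f' (axis i 1)"
proof -
  have "((\<lambda>t. u + t *\<^sub>R axis i (1::real)) has_derivative (\<lambda>t. t *\<^sub>R axis i 1)) (at 0)"
    by (auto intro!: derivative_eq_intros)
  \<comment> \<open>The base point is written as the value of the line at \<open>0\<close>, the form
    that the chain rule expects.\<close>
  moreover have "(f has_derivative f') (at (u + 0 *\<^sub>R axis i 1))"
    using assms by simp
  ultimately have "((\<lambda>t. f (u + t *\<^sub>R axis i 1)) has_derivative (\<lambda>t. f' (t *\<^sub>R axis i 1))) (at 0)"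
    by (rule has_derivative_compose)
  then have "((\<lambda>t. f (u + t *\<^sub>R axis i 1)) has_field_derivative f' (axis i 1)) (at 0)"
    by (simp add: has_field_derivative_def linear_cmul[OF has_derivative_linear[OF assms]]
        mult.commute[of _ "f' (axis i 1)"])
  then show ?thesis
    unfolding partial_deriv_def by (rule DERIV_imp_deriv)
qed

text \<open>Linearity of \<open>f'\<close> and the expansion of \<open>d\<close> in the standard
  basis. This brings a directional derivative into the form to which bounds on partial derivatives
  apply.\<close>

lemma has_derivative_eq_sum_partial_deriv:
  fixes f :: "real ^ 'n \<Rightarrow> real"
  assumes "(f has_derivative f') (at u)"
  shows "f' d = (\<Sum>i\<in>UNIV. d $ i * partial_deriv i f u)"
proof -
  have lin: "linear f'"
    using assms by (rule has_derivative_linear)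
  have "f' d = f' (\<Sum>i\<in>UNIV. d $ i *\<^sub>R axis i 1)"
    using basis_expansion[of d] by (simp add: scalar_mult_eq_scaleR)
  also have "\<dots> = (\<Sum>i\<in>UNIV. d $ i * f' (axis i 1))"
    by (simp add: linear_sum[OF lin] linear_cmul[OF lin])
  finally show ?thesis
    by (simp add: has_derivative_imp_partial_deriv[OF assms])
qed

text \<open>Termwise comparison: terms with \<open>d i = 0\<close> agree, so the strictness comes
  from \<open>i0\<close> alone.\<close>

lemma sum_mult_less_sum_mult_abs:
  fixes d p c :: "'i::finite \<Rightarrow> real"
  assumes "\<And>i. \<bar>p i\<bar> < c i" and "d i0 \<noteq> 0"
  shows "(\<Sum>i\<in>UNIV. d i * p i) < (\<Sum>i\<in>UNIV. c i * \<bar>d i\<bar>)"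
proof (rule sum_strict_mono_ex1)
  have le: "d i * p i \<le> \<bar>p i\<bar> * \<bar>d i\<bar>" for i
    by (metis abs_ge_self abs_mult mult.commute)
  have "\<bar>p i\<bar> * \<bar>d i\<bar> \<le> c i * \<bar>d i\<bar>" for i
    using assms(1)[of i] by (intro mult_right_mono) auto
  then show "\<forall>i\<in>UNIV. d i * p i \<le> c i * \<bar>d i\<bar>"
    using le order_trans by blast
  have "\<bar>p i0\<bar> * \<bar>d i0\<bar> < c i0 * \<bar>d i0\<bar>"
    using assms by (intro mult_strict_right_mono) auto
  with le[of i0] have "d i0 * p i0 < c i0 * \<bar>d i0\<bar>"
    by (rule le_less_trans)
  then show "\<exists>i\<in>UNIV. d i * p i < c i * \<bar>d i\<bar>"
    by blast
qed auto

lemma convex_input_box: "convex (input_box a b)"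
proof -
  have "input_box a b = cbox a b"
    by (auto simp: input_box_def mem_box_cart less_eq_vec_def)
  then show ?thesis
    by (simp add: convex_box)
qed

theorem theorem2:
  fixes uL uU u_k u_star u_next :: "real ^ 'n"
    and g :: "'m::finite \<Rightarrow> real ^ 'n \<Rightarrow> real"
    and \<kappa> :: "'m \<Rightarrow> 'n \<Rightarrow> real"
    and K :: real
  assumes g_C2: "\<And>j. C2_over (g j) (input_box uL uU)"
    and \<kappa>_bound: "\<And>u i j. u \<in> input_box uL uU \<Longrightarrow>
          - \<kappa> j i < partial_deriv i (g j) u \<and> partial_deriv i (g j) u < \<kappa> j i"
    and u_k_box: "u_k \<in> input_box uL uU"
    and u_k_feasible: "\<And>j. g j u_k < 0"
    and u_star_box: "u_star \<in> input_box uL uU"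
    and u_star_neq: "u_star \<noteq> u_k"
    and K_range: "K \<in> {0..1}"
    and u_next: "u_next = u_k + K *\<^sub>R (u_star - u_k)"
    and K_le: "K \<le> (MIN j\<in>UNIV. - g j u_k / (\<Sum>i\<in>UNIV. \<kappa> j i * \<bar>u_star $ i - u_k $ i\<bar>))"
  shows "\<forall>j. g j u_next < 0"
proof
  fix j
  define d where "d = u_star - u_k"
  define S where "S = (\<Sum>i\<in>UNIV. \<kappa> j i * \<bar>d $ i\<bar>)"
  obtain i0 where i0: "d $ i0 \<noteq> 0"
    using u_star_neq by (auto simp: d_def vec_eq_iff)
  have abs_bound: "\<bar>partial_deriv i (g j) u\<bar> < \<kappa> j i" if "u \<in> input_box uL uU" for u i
    using \<kappa>_bound[OF that, of j i] by (simp add: abs_less_iff)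
  have "0 < \<kappa> j i" for i
    using abs_bound[OF u_k_box, of i] by linarith
  \<comment> \<open>The case \<open>p = 0\<close> of the comparison lemma. Positivity of
    \<open>S\<close> allows the bound on \<open>K\<close> to be multiplied out.\<close>
  then have S_pos: "0 < S"
    unfolding S_def using sum_mult_less_sum_mult_abs[of "\<lambda>_. 0" "\<kappa> j" "($) d" i0] i0 by simp
  have "K \<le> - g j u_k / S"
    using K_le by (simp add: S_def d_def)
  then have KS: "K * S \<le> - g j u_k"
    using S_pos by (simp only: pos_le_divide_eq)
  show "g j u_next < 0"
  \<comment> \<open>For \<open>K = 0\<close> the segment degenerates to \<open>u_k\<close>; the mean
    value theorem and the strict inequality scaled by \<open>K\<close> both need
    \<open>0 < K\<close>.\<close>
  proof (cases "K = 0")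
    case True
    then show ?thesis
      using u_k_feasible u_next by simp
  next
    case False
    then have K: "0 < K" "K \<le> 1"
      using K_range by auto
    obtain g' where g': "(g j has_derivative g' u) (at u)" if "u \<in> input_box uL uU" for u
      using C2_over_imp_has_derivative[OF g_C2[of j]] by blast
    have seg: "u_k + t *\<^sub>R d \<in> input_box uL uU" if "0 \<le> t" "t \<le> K" for t
    proof -
      \<comment> \<open>A convex combination, since \<open>t \<le> K \<le> 1\<close>.\<close>
      have "(1 - t) *\<^sub>R u_k + t *\<^sub>R u_star \<in> input_box uL uU"
        using that K by (intro convexD[OF convex_input_box u_k_box u_star_box]) auto
      then show ?thesis
        by (simp add: d_def algebra_simps)
    qed
    \<comment> \<open>Over \<open>{0..K}\<close> the path runs from \<open>u_k\<close> exactly to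
      \<open>u_next\<close>.\<close>
    have "((\<lambda>t. g j (u_k + t *\<^sub>R d)) has_derivative (\<lambda>s. g' (u_k + t *\<^sub>R d) (s *\<^sub>R d)))
        (at t within {0..K})" if "0 \<le> t" "t \<le> K" for t
      by (rule has_derivative_compose[where f = "\<lambda>t. u_k + t *\<^sub>R d", OF _ g'[OF seg[OF that]]])
        (auto intro!: derivative_eq_intros)
    from mvt_simple[OF K(1) this] obtain t where t: "t \<in> {0<..<K}"
      and eq: "g j (u_k + K *\<^sub>R d) - g j u_k = g' (u_k + t *\<^sub>R d) (K *\<^sub>R d)"
      by auto
    define u where "u = u_k + t *\<^sub>R d"
    have u_box: "u \<in> input_box uL uU"
      using seg t by (simp add: u_def)
    have "g' u d = (\<Sum>i\<in>UNIV. d $ i * partial_deriv i (g j) u)"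
      by (rule has_derivative_eq_sum_partial_deriv[OF g'[OF u_box]])
    also have "\<dots> < S"
      unfolding S_def by (rule sum_mult_less_sum_mult_abs[where d = "($) d", OF abs_bound[OF u_box] i0])
    finally have "K * g' u d < K * S"
      using K by simp
    moreover have "g j u_next - g j u_k = K * g' u d"
      using eq by (simp add: u_next d_def[symmetric] u_def[symmetric]
          linear_cmul[OF has_derivative_linear[OF g'[OF u_box]]])
    \<comment> \<open>The increment of \<open>g j\<close> is below \<open>K * S\<close>, hence below
      \<open>- g j u_k\<close>.\<close>
    ultimately show ?thesis
      using KS by linarith
  qed
qed

end
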